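(* Let $n\ge1$, let $H\in\mathbb{R}^{n\times n}$ be symmetric and let $c\in\mathbb{R}^n$. Set $$A=\begin{bmatrix}H&0\\0&H\end{bmatrix}\in\mathbb{R}^{2n\times 2n},\qquad a=\begin{bmatrix}c\\0\end{bmatrix}\in\mathbb{R}^{2n},\qquad f(z)=\tfrac12z^TAz+a^Tz,$$ let $B_{2n}=\{z\in\mathbb{R}^{2n}: z^Tz\le 1\}$, and let $L=\|A\|_2=\|H\|_2$ be the spectral norm. For any constant step size $\eta\in(0,2/L)$, let $\{z^k\}_{k=0}^\infty$ be the sequence generated by the projected gradient method $$z^{k+1}=P_{B_{2n}}\big(z^k-\eta\nabla f(z^k)\big),\qquad k=0,1,2,\dots,$$ with $z^0$ uniformly and randomly selected from $B_{2n}$. Then, with probability one, $\{z^k\}_{k=0}^\infty$ converges to a global minimizer of $\min\{f(z): z\in B_{2n}\}$.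
   Context: $P_{B_{2n}}$ denotes Euclidean projection onto the unit ball: $P_{B_{2n}}(w)=w$ if $\|w\|\le 1$ and $P_{B_{2n}}(w)=w/\|w\|$ otherwise. Here $\nabla f(z)=Az+a$. *)

theory Defs
  imports "HOL-Probability.Probability"
begin

text \<open>
  The space of dimension \<open>2n\<close> is \<open>real ^ ('n + 'n)\<close>: the indices \<open>Inl i\<close> select the upper block
  and the indices \<open>Inr i\<close> the lower one.
\<close>

definition block_diag :: "real ^ 'n ^ 'n \<Rightarrow> real ^ ('n + 'n) ^ ('n + 'n)" where
  "block_diag H = (\<chi> i j. case (i, j) of
      (Inl i', Inl j') \<Rightarrow> H $ i' $ j'
    | (Inr i', Inr j') \<Rightarrow> H $ i' $ j'
    | _ \<Rightarrow> 0)"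

definition pad_zero :: "real ^ 'n \<Rightarrow> real ^ ('n + 'n)" where
  "pad_zero c = (\<chi> i. case i of Inl i' \<Rightarrow> c $ i' | Inr _ \<Rightarrow> 0)"

definition quad_fun :: "real ^ 'm ^ 'm \<Rightarrow> real ^ 'm \<Rightarrow> real ^ 'm \<Rightarrow> real" where
  "quad_fun A a z = 1 / 2 * (z \<bullet> (A *v z)) + a \<bullet> z"

definition quad_grad :: "real ^ 'm ^ 'm \<Rightarrow> real ^ 'm \<Rightarrow> real ^ 'm \<Rightarrow> real ^ 'm" where
  "quad_grad A a z = A *v z + a"

definition unit_ball :: "(real ^ 'm) set" where
  "unit_ball = {z. z \<bullet> z \<le> 1}"

definition proj_ball :: "real ^ 'm \<Rightarrow> real ^ 'm" where
  "proj_ball w = (if norm w \<le> 1 then w else w /\<^sub>R norm w)"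

definition spectral_norm :: "real ^ 'm ^ 'm \<Rightarrow> real" where
  "spectral_norm A = onorm ((*v) A)"

lemma unit_ball_eq_cball: "unit_ball = cball 0 1"
  by (auto simp: unit_ball_def norm_eq_sqrt_inner)

lemma proj_ball_eq_closest_point: "proj_ball w = closest_point unit_ball w"
proof (cases "norm w \<le> 1")
  case True
  then show ?thesis
    by (simp add: proj_ball_def unit_ball_eq_cball closest_point_self)
next
  case False
  then have "w \<noteq> 0" by auto
  have "w /\<^sub>R norm w = closest_point (cball 0 1) w"
  proof (rule closest_point_unique)
    have "dist w (w /\<^sub>R norm w) = norm w - 1"
    proof -
      have "w - w /\<^sub>R norm w = (1 - 1 / norm w) *\<^sub>R w"
        by (simp add: scaleR_left_diff_distrib divide_inverse)
      moreover have "norm ((1 - 1 / norm w) *\<^sub>R w) = norm w - 1"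
      proof -
        have "1 / norm w \<le> 1"
          using False by (simp add: divide_le_eq_1)
        then have "norm ((1 - 1 / norm w) *\<^sub>R w) = (1 - 1 / norm w) * norm w"
          by simp
        also have "\<dots> = norm w - 1"
          using False by (auto simp: field_simps)
        finally show ?thesis .
      qed
      ultimately show ?thesis by (simp add: dist_norm)
    qed
    moreover have "norm w - 1 \<le> dist w v" if "v \<in> cball 0 1" for v
      using that norm_triangle_ineq2[of w v] by (simp add: dist_norm)
    ultimately show "\<forall>v\<in>cball 0 1. dist w (w /\<^sub>R norm w) \<le> dist w v"
      by simp
  qed (use False \<open>w \<noteq> 0\<close> in auto)
  with False show ?thesis
    by (simp add: proj_ball_def unit_ball_eq_cball)
qed

lemma transpose_block_diag:
  "transpose H = H \<Longrightarrow> transpose (block_diag H) = block_diag H"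
  by (auto simp: transpose_def block_diag_def vec_eq_iff split: sum.split)

lemma gderiv_quad_fun:
  assumes "transpose A = A"
  shows "GDERIV (quad_fun A a) z :> quad_grad A a z"
proof -
  have lin: "((\<lambda>z. A *v z) has_derivative (\<lambda>h. A *v h)) (at z)"
    by (intro bounded_linear_imp_has_derivative matrix_vector_mul_bounded_linear)
  have sym: "z \<bullet> (A *v h) = h \<bullet> (A *v z)" for h
    using assms by (metis dot_lmul_matrix inner_commute transpose_matrix_vector)
  show ?thesis
    unfolding gderiv_def quad_fun_def quad_grad_def
    by (rule has_derivative_eq_rhs, (rule derivative_intros lin)+)
      (auto simp: sym inner_add_right inner_commute fun_eq_iff)
qed

lemma sum_UNIV_Plus:
  fixes g :: "'a::finite + 'b::finite \<Rightarrow> real"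
  shows "(\<Sum>i\<in>UNIV. g i) = (\<Sum>i\<in>UNIV. g (Inl i)) + (\<Sum>i\<in>UNIV. g (Inr i))"
  by (subst UNIV_Plus_UNIV[symmetric], subst sum.Plus) auto

lemma spectral_norm_block_diag:
  fixes H :: "real ^ 'n::finite ^ 'n"
  shows "spectral_norm (block_diag H) = spectral_norm H"
proof -
  define up :: "real ^ ('n + 'n) \<Rightarrow> real ^ 'n" where "up z = (\<chi> i. z $ Inl i)" for z
  define lo :: "real ^ ('n + 'n) \<Rightarrow> real ^ 'n" where "lo z = (\<chi> i. z $ Inr i)" for z
  have norm_split: "(norm z)\<^sup>2 = (norm (up z))\<^sup>2 + (norm (lo z))\<^sup>2" for z
    by (simp add: power2_norm_eq_inner inner_vec_def sum_UNIV_Plus up_def lo_def)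
  have up_mul: "up (block_diag H *v z) = H *v up z" for z
    by (simp add: vec_eq_iff up_def matrix_vector_mult_def block_diag_def sum_UNIV_Plus)
  have lo_mul: "lo (block_diag H *v z) = H *v lo z" for z
    by (simp add: vec_eq_iff lo_def matrix_vector_mult_def block_diag_def sum_UNIV_Plus)
  have blH: "bounded_linear ((*v) H)" and blA: "bounded_linear ((*v) (block_diag H))"
    by (rule matrix_vector_mul_bounded_linear)+
  have "onorm ((*v) (block_diag H)) \<le> onorm ((*v) H)"
  proof (rule onorm_le)
    fix z :: "real ^ ('n + 'n)"
    let ?L = "onorm ((*v) H)"
    have "(norm (block_diag H *v z))\<^sup>2 = (norm (H *v up z))\<^sup>2 + (norm (H *v lo z))\<^sup>2"
      by (simp add: norm_split up_mul lo_mul)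
    also have "\<dots> \<le> (?L * norm (up z))\<^sup>2 + (?L * norm (lo z))\<^sup>2"
      by (intro add_mono power_mono onorm[OF blH]) auto
    also have "\<dots> = (?L * norm z)\<^sup>2"
      by (simp add: power_mult_distrib norm_split distrib_left)
    finally show "norm (block_diag H *v z) \<le> ?L * norm z"
      by (rule power2_le_imp_le) (simp add: onorm_pos_le[OF blH])
  qed
  moreover have "onorm ((*v) H) \<le> onorm ((*v) (block_diag H))"
  proof (rule onorm_le)
    fix x :: "real ^ 'n"
    have up: "up (pad_zero x) = x" and lo: "lo (pad_zero x) = 0"
      by (simp_all add: vec_eq_iff up_def lo_def pad_zero_def)
    have "(norm (block_diag H *v pad_zero x))\<^sup>2 = (norm (H *v x))\<^sup>2"
      by (simp add: norm_split up_mul lo_mul up lo)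
    moreover have "(norm (pad_zero x))\<^sup>2 = (norm x)\<^sup>2"
      by (simp add: norm_split up lo)
    ultimately show "norm (H *v x) \<le> onorm ((*v) (block_diag H)) * norm x"
      using onorm[OF blA, of "pad_zero x"] by simp
  qed
  ultimately show ?thesis
    by (simp add: spectral_norm_def)
qed

end

theory Submission
  imports Defs
begin

text \<open>
  A fixed point \<open>p\<close> of the projected gradient map satisfies \<open>A p + a + \<sigma> p = 0\<close> for a
  multiplier \<open>\<sigma> \<ge> 0\<close>, and \<open>\<sigma>\<close> depends only on \<open>f p\<close>. As \<open>f\<close> decreases along the iterates,
  all cluster points are fixed points with the same \<open>f\<close>-value, so the multipliers of the iterates
  converge to some \<open>\<sigma>\<close> even before convergence of the iterates is known.

  Let \<open>\<lambda>\<close> be the least eigenvalue of \<open>H\<close> and \<open>v\<close> an eigenvector placed in the lower block,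
  where \<open>a\<close> vanishes. Then \<open>z k \<bullet> v\<close> follows a power iteration with factors tending to
  \<open>(1 - \<eta> \<lambda>) / (1 + \<eta> \<sigma>)\<close>. It is bounded and almost surely starts at a nonzero value, so
  \<open>\<sigma> \<ge> - \<lambda>\<close>, which makes every cluster point a global minimizer. If \<open>\<sigma> > - \<lambda>\<close>, the cluster
  point is unique because \<open>A + \<sigma>\<close> is positive definite. If \<open>\<sigma> = - \<lambda>\<close>, two cluster points differ
  by an element of the kernel of \<open>A + \<sigma>\<close>, on which all components of the iterates are multiplied by
  the same factors; the condition \<open>norm p = 1\<close> (if \<open>\<sigma> > 0\<close>) or monotonicity (if \<open>\<sigma> = 0\<close>)
  then forces the two points to agree.
\<close>

text \<open>If \<open>g (z k)\<close> stayed away from \<open>l\<close> along a subsequence,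
  compactness would yield a cluster point there with a value other than \<open>l\<close>. Applied
  below to the multiplier and to the identity map.\<close>

lemma tendsto_if_cluster_values_eq:
  fixes z :: "nat \<Rightarrow> 'a::metric_space" and g :: "'a \<Rightarrow> 'b::metric_space"
  assumes "compact S" and z: "\<And>k. z k \<in> S" and cont: "\<And>x. isCont g x"
    and cl: "\<And>r p. strict_mono r \<Longrightarrow> (z \<circ> r) \<longlonglongrightarrow> p \<Longrightarrow> g p = l"
  shows "(\<lambda>k. g (z k)) \<longlonglongrightarrow> l"
proof (rule ccontr)
  assume "\<not> ?thesis"
  then obtain e where e: "e > 0" and "\<not> (\<forall>\<^sub>F k in sequentially. dist (g (z k)) l < e)"
    unfolding tendsto_iff by blast
  then have "infinite {k. \<not> dist (g (z k)) l < e}"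
    by (simp add: cofinite_eq_sequentially[symmetric] eventually_cofinite)
  then obtain r :: "nat \<Rightarrow> nat" where r: "strict_mono r" "\<And>k. r k \<in> {k. \<not> dist (g (z k)) l < e}"
    by (metis infinite_enumerate)
  obtain p q where q: "strict_mono q" "((z \<circ> r) \<circ> q) \<longlonglongrightarrow> p"
    using \<open>compact S\<close> z unfolding compact_def by (metis comp_apply)
  have "strict_mono (r \<circ> q)" using r(1) q(1) by (rule strict_mono_o)
  then have "g p = l" using cl q(2) by (simp add: comp_assoc)
  then have "(\<lambda>k. g (z (r (q k)))) \<longlonglongrightarrow> l"
    using isCont_tendsto_compose[OF cont q(2)] by (simp add: comp_def)
  then have "\<forall>\<^sub>F k in sequentially. dist (g (z (r (q k)))) l < e"
    using e by (rule tendstoD)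
  then obtain k where "dist (g (z (r (q k)))) l < e"
    by (auto simp: eventually_sequentially)
  then show False using r(2) by simp
qed

section \<open>Least eigenvalue of a symmetric matrix\<close>

lemma nonneg_quadratic_imp_linear_zero:
  fixes b d :: real
  assumes "\<And>t. 0 \<le> 2 * t * b + t\<^sup>2 * d"
  shows "b = 0"
proof (cases "d \<le> 0")
  case True
  then show ?thesis using assms[of 1] assms[of "-1"] by simp
next
  case False
  \<comment> \<open>For \<open>d > 0\<close> the parabola has its minimum at
    \<open>t = - b / d\<close>.\<close>
  have "2 * (- b / d) * b + (- b / d)\<^sup>2 * d = - (b\<^sup>2 / d)"
    using False by (simp add: power2_eq_square field_simps)
  with assms[of "- b / d"] have "b\<^sup>2 / d \<le> 0" by linarith
  then show ?thesis using False by (simp add: divide_le_0_iff)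
qed

lemma symmetric_matrix_inner:
  fixes A :: "real ^ 'm ^ 'm"
  assumes "transpose A = A"
  shows "x \<bullet> (A *v y) = (A *v x) \<bullet> y"
  using assms by (metis dot_lmul_matrix transpose_matrix_vector)

text \<open>The form of \<open>A - lam\<close> is nonnegative and vanishes at \<open>x\<close>, so
  its first variation there is zero in every direction. Taking the residual \<open>d\<close> itself
  as the direction makes this variation a multiple of \<open>d \<bullet> d\<close>.\<close>

lemma rayleigh_minimizer_eigenvector:
  fixes A :: "real ^ 'm ^ 'm"
  assumes sym: "transpose A = A" and psd: "\<And>x. lam * (x \<bullet> x) \<le> x \<bullet> (A *v x)"
    and "x \<bullet> (A *v x) = lam * (x \<bullet> x)"
  shows "A *v x = lam *\<^sub>R x"
proof -
  define d where "d = A *v x - lam *\<^sub>R x"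
  have "0 \<le> 2 * t * (d \<bullet> d) + t\<^sup>2 * (d \<bullet> (A *v d) - lam * (d \<bullet> d))" for t
  proof -
    have "0 \<le> (x + t *\<^sub>R d) \<bullet> (A *v (x + t *\<^sub>R d)) - lam * ((x + t *\<^sub>R d) \<bullet> (x + t *\<^sub>R d))"
      using psd[of "x + t *\<^sub>R d"] by linarith
    also have "\<dots> = 2 * t * (d \<bullet> (A *v x) - lam * (d \<bullet> x)) + t\<^sup>2 * (d \<bullet> (A *v d) - lam * (d \<bullet> d))"
      using assms(3)
      by (simp add: matrix_vector_right_distrib matrix_vector_mult_scaleR inner_add_left inner_add_right
          symmetric_matrix_inner[OF sym, of x d] inner_commute power2_eq_square algebra_simps)
    also have "d \<bullet> (A *v x) - lam * (d \<bullet> x) = d \<bullet> d"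
      by (simp add: d_def inner_diff_right algebra_simps)
    finally show ?thesis .
  qed
  then have "d \<bullet> d = 0" by (rule nonneg_quadratic_imp_linear_zero)
  then show ?thesis by (simp add: d_def)
qed

text \<open>The Rayleigh quotient attains its minimum on the compact unit sphere; homogeneity
  carries the bound to all vectors.\<close>

lemma symmetric_matrix_least_eigenvalue:
  fixes A :: "real ^ 'm ^ 'm"
  assumes sym: "transpose A = A"
  obtains lam v where "v \<noteq> 0" "A *v v = lam *\<^sub>R v" "\<And>x. lam * (x \<bullet> x) \<le> x \<bullet> (A *v x)"
proof -
  have "\<exists>v \<in> sphere (0 :: real ^ 'm) 1. \<forall>x \<in> sphere 0 1. v \<bullet> (A *v v) \<le> x \<bullet> (A *v x)"
  proof (rule continuous_attains_inf)
    show "sphere (0 :: real ^ 'm) 1 \<noteq> {}" using vector_choose_size[of 1] by fastforce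
    show "continuous_on (sphere 0 1) (\<lambda>x. x \<bullet> (A *v x))"
      by (intro continuous_intros bounded_linear.continuous_on[OF matrix_vector_mul_bounded_linear])
  qed auto
  then obtain v where v: "norm v = 1" and min: "\<And>x. norm x = 1 \<Longrightarrow> v \<bullet> (A *v v) \<le> x \<bullet> (A *v x)"
    by auto
  have psd: "v \<bullet> (A *v v) * (x \<bullet> x) \<le> x \<bullet> (A *v x)" for x
  proof (cases "x = 0")
    case False
    then have "v \<bullet> (A *v v) \<le> (x /\<^sub>R norm x) \<bullet> (A *v (x /\<^sub>R norm x))"
      by (intro min) simp
    also have "\<dots> = (x \<bullet> (A *v x)) / (norm x)\<^sup>2"
      by (simp add: matrix_vector_mult_scaleR power2_eq_square field_simps)
    finally show ?thesis using False by (simp add: field_simps power2_norm_eq_inner)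
  qed simp
  show ?thesis
  proof (rule that)
    show "v \<noteq> 0" using v by auto
    show "A *v v = (v \<bullet> (A *v v)) *\<^sub>R v"
      by (rule rayleigh_minimizer_eigenvector[OF sym psd]) (use v in \<open>simp add: norm_eq_1\<close>)
  qed (rule psd)
qed

lemma proj_ball_scaleR: "proj_ball w = (1 / max 1 (norm w)) *\<^sub>R w"
  by (auto simp: proj_ball_def max_def divide_inverse)

text \<open>The second-order Taylor expansion is exact for a quadratic; symmetry merges the two
  cross terms.\<close>

lemma quad_fun_diff:
  fixes A :: "real ^ 'm ^ 'm"
  assumes "transpose A = A"
  shows "quad_fun A a w - quad_fun A a x = quad_grad A a x \<bullet> (w - x) + 1 / 2 * ((w - x) \<bullet> (A *v (w - x)))"
  using symmetric_matrix_inner[OF assms, of x w]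
  by (simp add: quad_fun_def quad_grad_def matrix_vector_mult_diff_distrib inner_commute algebra_simps)

lemma eigenvector_diff:
  assumes "quad_grad A a p = s *\<^sub>R p" "quad_grad A a q = s *\<^sub>R q"
  shows "A *v (p - q) = s *\<^sub>R (p - q)"
proof -
  have "A *v (p - q) = quad_grad A a p - quad_grad A a q"
    by (simp add: quad_grad_def matrix_vector_mult_diff_distrib)
  then show ?thesis by (simp add: assms scaleR_diff_right)
qed

section \<open>Descent along a single trajectory\<close>

text \<open>The randomness is left out: \<open>z\<close> is one realized trajectory. The step bound
  is a product so that it also covers spectral norm 0.\<close>

locale projected_gradient =
  fixes A :: "real ^ 'm ^ 'm" and a :: "real ^ 'm" and \<eta> :: real and z :: "nat \<Rightarrow> real ^ 'm"
  assumes sym: "transpose A = A"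
    and \<eta>_pos: "0 < \<eta>"
    and \<eta>_less: "\<eta> * spectral_norm A < 2"
    and z0: "z 0 \<in> unit_ball"
    and step: "z (Suc k) = proj_ball (z k - \<eta> *\<^sub>R quad_grad A a (z k))"
begin

text \<open>Chosen so that the projection divides the gradient step by
  \<open>1 + \<eta> * multiplier x\<close>. At a fixed point it is the KKT multiplier of the ball
  constraint, but it is defined and continuous everywhere, so it can be followed along the
  iterates.\<close>

definition multiplier :: "real ^ 'm \<Rightarrow> real" where
  "multiplier x = (max 1 (norm (x - \<eta> *\<^sub>R quad_grad A a x)) - 1) / \<eta>"

lemma multiplier_nonneg: "0 \<le> multiplier x"
  using \<eta>_pos by (simp add: multiplier_def)

lemma denominator_pos: "0 < 1 + \<eta> * multiplier x"
  using \<eta>_pos multiplier_nonneg[of x] by (simp add: add_pos_nonneg)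

lemma proj_ball_multiplier:
  "proj_ball (x - \<eta> *\<^sub>R quad_grad A a x) = (1 / (1 + \<eta> * multiplier x)) *\<^sub>R (x - \<eta> *\<^sub>R quad_grad A a x)"
  using \<eta>_pos by (simp add: proj_ball_scaleR multiplier_def)

lemma isCont_grad_step: "isCont (\<lambda>x. x - \<eta> *\<^sub>R quad_grad A a x) x"
  unfolding quad_grad_def
  by (intro continuous_intros bounded_linear.isCont[OF matrix_vector_mul_bounded_linear])

lemma isCont_multiplier: "isCont multiplier x"
  unfolding multiplier_def using \<eta>_pos
  by (intro continuous_intros isCont_grad_step) auto

lemma isCont_step: "isCont (\<lambda>x. proj_ball (x - \<eta> *\<^sub>R quad_grad A a x)) x"
  unfolding proj_ball_scaleR by (intro continuous_intros isCont_grad_step) auto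

lemma z_in_ball: "z k \<in> unit_ball"
proof (cases k)
  case (Suc j)
  show ?thesis
    unfolding Suc step proj_ball_eq_closest_point
    by (rule closest_point_in_set) (auto simp: unit_ball_eq_cball)
qed (simp add: z0)

lemma norm_z_le: "norm (z k) \<le> 1"
  using z_in_ball[of k] by (simp add: unit_ball_eq_cball)

text \<open>The obtuse-angle inequality of the projection, tested against \<open>z k\<close>, bounds
  the linear Taylor term by \<open>- (d \<bullet> d) / \<eta>\<close>; the spectral norm bounds the
  quadratic one.\<close>

lemma quad_fun_descent:
  "quad_fun A a (z (Suc k)) + (1 / \<eta> - spectral_norm A / 2) * (norm (z (Suc k) - z k))\<^sup>2
    \<le> quad_fun A a (z k)"
proof -
  define d where "d = z (Suc k) - z k"
  define g where "g = quad_grad A a (z k)"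
  have "(z k - \<eta> *\<^sub>R g - z (Suc k)) \<bullet> (z k - z (Suc k)) \<le> 0"
    unfolding step g_def proj_ball_eq_closest_point
    by (rule closest_point_dot) (use z_in_ball in \<open>auto simp: unit_ball_eq_cball\<close>)
  also have "(z k - \<eta> *\<^sub>R g - z (Suc k)) \<bullet> (z k - z (Suc k)) = d \<bullet> d + \<eta> * (g \<bullet> d)"
    by (simp add: d_def inner_commute algebra_simps)
  finally have "g \<bullet> d \<le> - (1 / \<eta>) * (d \<bullet> d)"
    using \<eta>_pos by (simp add: field_simps)
  moreover have "d \<bullet> (A *v d) \<le> spectral_norm A * (d \<bullet> d)"
  proof -
    have "d \<bullet> (A *v d) \<le> norm d * norm (A *v d)" by (rule norm_cauchy_schwarz)
    also have "\<dots> \<le> norm d * (spectral_norm A * norm d)"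
      unfolding spectral_norm_def
      by (intro mult_left_mono onorm matrix_vector_mul_bounded_linear) auto
    finally show ?thesis by (simp add: dot_square_norm power2_eq_square algebra_simps)
  qed
  ultimately show ?thesis
    using quad_fun_diff[OF sym, of a "z (Suc k)" "z k"]
    by (simp add: d_def[symmetric] g_def[symmetric] power2_norm_eq_inner algebra_simps)
qed

lemma descent_const_pos: "0 < 1 / \<eta> - spectral_norm A / 2"
  using \<eta>_pos \<eta>_less by (simp add: field_simps)

lemma decseq_quad_fun: "decseq (\<lambda>k. quad_fun A a (z k))"
proof (rule decseq_SucI)
  fix k
  have "0 \<le> (1 / \<eta> - spectral_norm A / 2) * (norm (z (Suc k) - z k))\<^sup>2"
    using descent_const_pos by (intro mult_nonneg_nonneg) auto
  then show "quad_fun A a (z (Suc k)) \<le> quad_fun A a (z k)"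
    using quad_fun_descent[of k] by linarith
qed

lemma isCont_quad_fun: "isCont (quad_fun A a) x"
  unfolding quad_fun_def
  by (intro continuous_intros bounded_linear.isCont[OF matrix_vector_mul_bounded_linear])

lemma compact_unit_ball: "compact (unit_ball :: (real ^ 'm) set)"
  by (simp add: unit_ball_eq_cball)

lemma quad_fun_convergent: "\<exists>l. (\<lambda>k. quad_fun A a (z k)) \<longlonglongrightarrow> l"
proof -
  have "compact (quad_fun A a ` unit_ball)"
    by (intro compact_continuous_image compact_unit_ball continuous_at_imp_continuous_on ballI
        isCont_quad_fun)
  then obtain B where "\<And>x. x \<in> unit_ball \<Longrightarrow> \<bar>quad_fun A a x\<bar> \<le> B"
    using compact_imp_bounded bounded_iff by (metis imageI real_norm_def)
  then have "- B \<le> quad_fun A a (z k)" for k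
    using z_in_ball[of k] by (metis abs_le_D2 minus_le_iff)
  then show ?thesis by (metis decseq_convergent[OF decseq_quad_fun])
qed

text \<open>By the descent inequality the squared increments are dominated by differences of
  consecutive terms of a convergent sequence.\<close>

lemma increments_tendsto_0: "(\<lambda>k. z (Suc k) - z k) \<longlonglongrightarrow> 0"
proof -
  let ?c = "1 / \<eta> - spectral_norm A / 2" and ?f = "\<lambda>k. quad_fun A a (z k)"
  obtain l where l: "?f \<longlonglongrightarrow> l" using quad_fun_convergent by blast
  have "(\<lambda>k. (?f k - ?f (Suc k)) / ?c) \<longlonglongrightarrow> (l - l) / ?c"
    by (intro tendsto_intros l LIMSEQ_Suc) (use descent_const_pos in auto)
  then have lim: "(\<lambda>k. (?f k - ?f (Suc k)) / ?c) \<longlonglongrightarrow> 0" by simp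
  have "(\<lambda>k. (norm (z (Suc k) - z k))\<^sup>2) \<longlonglongrightarrow> 0"
  proof (rule tendsto_sandwich[OF _ _ tendsto_const lim])
    have "(norm (z (Suc k) - z k))\<^sup>2 \<le> (?f k - ?f (Suc k)) / ?c" for k
      unfolding pos_le_divide_eq[OF descent_const_pos]
      using quad_fun_descent[of k] by (simp add: mult.commute)
    then show "\<forall>\<^sub>F k in sequentially. (norm (z (Suc k) - z k))\<^sup>2 \<le> (?f k - ?f (Suc k)) / ?c"
      by simp
  qed simp
  then have "(\<lambda>k. sqrt ((norm (z (Suc k) - z k))\<^sup>2)) \<longlonglongrightarrow> sqrt 0"
    by (rule tendsto_real_sqrt)
  then show ?thesis by (simp add: tendsto_norm_zero_iff)
qed

section \<open>Cluster points, stationarity and multipliers\<close>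

text \<open>As the increments vanish, the subsequence shifted by one step also tends to
  \<open>p\<close>; by continuity of the step map it tends to the image of \<open>p\<close> as
  well.\<close>

lemma cluster_point_fixed:
  assumes r: "strict_mono r" and p: "(z \<circ> r) \<longlonglongrightarrow> p"
  shows "proj_ball (p - \<eta> *\<^sub>R quad_grad A a p) = p"
proof -
  have "(\<lambda>k. z (r k) + (z (Suc (r k)) - z (r k))) \<longlonglongrightarrow> p + 0"
    using p LIMSEQ_subseq_LIMSEQ[OF increments_tendsto_0 r]
    by (intro tendsto_add) (simp_all add: comp_def)
  then have "(\<lambda>k. z (Suc (r k))) \<longlonglongrightarrow> p" by simp
  moreover have "(\<lambda>k. z (Suc (r k))) \<longlonglongrightarrow> proj_ball (p - \<eta> *\<^sub>R quad_grad A a p)"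
    using isCont_tendsto_compose[OF isCont_step p] by (simp add: step comp_def)
  ultimately show ?thesis by (rule LIMSEQ_unique[symmetric])
qed

text \<open>These are the KKT conditions, the last one being complementary slackness: either the
  gradient step stays in the ball and the multiplier is 0, or the projection lands on the
  sphere.\<close>

lemma fixed_point_stationary:
  assumes fp: "proj_ball (p - \<eta> *\<^sub>R quad_grad A a p) = p"
  shows "quad_grad A a p = - multiplier p *\<^sub>R p"
    and "p \<in> unit_ball"
    and "multiplier p * (p \<bullet> p) = multiplier p"
proof -
  let ?s = "1 + \<eta> * multiplier p" and ?w = "p - \<eta> *\<^sub>R quad_grad A a p"
  have "?s *\<^sub>R p = ?s *\<^sub>R ((1 / ?s) *\<^sub>R ?w)"
    using fp proj_ball_multiplier[of p] by simp
  also have "\<dots> = ?w" using denominator_pos[of p] by simp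
  finally have "\<eta> *\<^sub>R quad_grad A a p = \<eta> *\<^sub>R (- multiplier p *\<^sub>R p)"
    by (simp add: algebra_simps eq_neg_iff_add_eq_0)
  then show "quad_grad A a p = - multiplier p *\<^sub>R p"
    using \<eta>_pos by (metis less_irrefl real_vector.scale_left_imp_eq)
  have "closest_point unit_ball ?w \<in> unit_ball"
    by (rule closest_point_in_set) (auto simp: unit_ball_eq_cball)
  then show "p \<in> unit_ball" by (simp add: proj_ball_eq_closest_point[symmetric] fp)
  show "multiplier p * (p \<bullet> p) = multiplier p"
  proof (cases "norm ?w \<le> 1")
    case True
    then show ?thesis by (simp add: multiplier_def)
  next
    case False
    then have "norm (proj_ball ?w) = 1" by (cases "?w = 0") (auto simp: proj_ball_def)
    then have "norm p = 1" by (simp only: fp)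
    then show ?thesis by (simp add: norm_eq_1)
  qed
qed

text \<open>
  Symmetry of \<open>A\<close> gives \<open>(\<sigma> - \<tau>) * (p \<bullet> q) = a \<bullet> (p - q)\<close> for the multipliers \<open>\<sigma>\<close>, \<open>\<tau>\<close> of
  \<open>p\<close>, \<open>q\<close>, and \<open>2 f p = a \<bullet> p - \<sigma>\<close> turns the right-hand side into \<open>\<sigma> - \<tau>\<close>.
  Hence \<open>\<sigma> \<noteq> \<tau>\<close> would force \<open>p \<bullet> q = 1\<close>, that is \<open>p = q\<close>.
\<close>
lemma multiplier_determined_by_value:
  assumes p: "proj_ball (p - \<eta> *\<^sub>R quad_grad A a p) = p"
    and q: "proj_ball (q - \<eta> *\<^sub>R quad_grad A a q) = q"
    and eq: "quad_fun A a p = quad_fun A a q"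
  shows "multiplier p = multiplier q"
proof (rule ccontr)
  assume ne: "multiplier p \<noteq> multiplier q"
  have Ap: "A *v p = - multiplier p *\<^sub>R p - a"
    using fixed_point_stationary(1)[OF p] by (simp add: quad_grad_def algebra_simps eq_diff_eq)
  have Aq: "A *v q = - multiplier q *\<^sub>R q - a"
    using fixed_point_stationary(1)[OF q] by (simp add: quad_grad_def algebra_simps eq_diff_eq)
  have "multiplier p * (p \<bullet> q) + a \<bullet> q = multiplier q * (p \<bullet> q) + a \<bullet> p"
    using symmetric_matrix_inner[OF sym, of p q]
    by (simp add: Ap Aq inner_diff_left inner_diff_right inner_commute algebra_simps)
  moreover have "a \<bullet> p - multiplier p = a \<bullet> q - multiplier q"
  proof -
    have "2 * quad_fun A a x = a \<bullet> x - multiplier x"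
      if "A *v x = - multiplier x *\<^sub>R x - a" "multiplier x * (x \<bullet> x) = multiplier x" for x
    proof -
      have "x \<bullet> (A *v x) = - (multiplier x * (x \<bullet> x)) - a \<bullet> x"
        by (simp add: that(1) inner_diff_right inner_commute)
      then show ?thesis unfolding that(2) by (simp add: quad_fun_def field_simps)
    qed
    from this[OF Ap fixed_point_stationary(3)[OF p]] this[OF Aq fixed_point_stationary(3)[OF q]]
    show ?thesis using eq by simp
  qed
  ultimately have "(multiplier p - multiplier q) * (p \<bullet> q - 1) = 0"
    by (simp add: algebra_simps)
  then have "p \<bullet> q = 1" using ne by simp
  moreover have "p \<bullet> p \<le> 1" "q \<bullet> q \<le> 1"
    using fixed_point_stationary(2)[OF p] fixed_point_stationary(2)[OF q]
    by (simp_all add: unit_ball_def)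
  moreover have "(p - q) \<bullet> (p - q) = p \<bullet> p + q \<bullet> q - 2 * (p \<bullet> q)"
    by (simp add: inner_commute algebra_simps)
  ultimately have "(p - q) \<bullet> (p - q) \<le> 0" by linarith
  then have "p = q" by (metis inner_eq_zero_iff inner_ge_zero order_antisym right_minus_eq)
  with ne show False by simp
qed

lemma multiplier_converges:
  obtains \<sigma> where "(\<lambda>k. multiplier (z k)) \<longlonglongrightarrow> \<sigma>"
    and "\<And>r p. strict_mono r \<Longrightarrow> (z \<circ> r) \<longlonglongrightarrow> p \<Longrightarrow> multiplier p = \<sigma>"
proof -
  obtain l where l: "(\<lambda>k. quad_fun A a (z k)) \<longlonglongrightarrow> l" using quad_fun_convergent by blast
  have val: "quad_fun A a p = l" if r: "strict_mono r" and p: "(z \<circ> r) \<longlonglongrightarrow> p" for r p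
  proof (rule LIMSEQ_unique)
    show "(\<lambda>k. quad_fun A a (z (r k))) \<longlonglongrightarrow> l"
      using LIMSEQ_subseq_LIMSEQ[OF l r] by (simp add: comp_def)
    show "(\<lambda>k. quad_fun A a (z (r k))) \<longlonglongrightarrow> quad_fun A a p"
      using isCont_tendsto_compose[OF isCont_quad_fun p] by (simp add: comp_def)
  qed
  obtain q s where s: "strict_mono s" and q: "(z \<circ> s) \<longlonglongrightarrow> q"
    using compact_unit_ball z_in_ball unfolding compact_def by metis
  have cl: "multiplier p = multiplier q" if r: "strict_mono r" and p: "(z \<circ> r) \<longlonglongrightarrow> p" for r p
    by (rule multiplier_determined_by_value[OF cluster_point_fixed[OF r p] cluster_point_fixed[OF s q]])
      (simp only: val[OF r p] val[OF s q])
  show ?thesis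
  proof (rule that)
    show "(\<lambda>k. multiplier (z k)) \<longlonglongrightarrow> multiplier q"
      by (rule tendsto_if_cluster_values_eq[OF compact_unit_ball z_in_ball isCont_multiplier])
        (rule cl)
  qed (rule cl)
qed

text \<open>Positive semidefiniteness of \<open>A + \<sigma>\<close> makes the Lagrangian convex, so
  its stationary point \<open>p\<close> minimizes it. Complementary slackness turns the remaining
  terms into \<open>\<sigma> * (1 - w \<bullet> w) / 2\<close>, which is nonnegative on the
  ball.\<close>

lemma fixed_point_global_min:
  assumes p: "proj_ball (p - \<eta> *\<^sub>R quad_grad A a p) = p"
    and psd: "\<And>x. - multiplier p * (x \<bullet> x) \<le> x \<bullet> (A *v x)"
    and w: "w \<in> unit_ball"
  shows "quad_fun A a p \<le> quad_fun A a w"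
proof -
  let ?\<sigma> = "multiplier p"
  have "quad_fun A a w - quad_fun A a p = - ?\<sigma> * (p \<bullet> (w - p)) + 1 / 2 * ((w - p) \<bullet> (A *v (w - p)))"
    by (simp add: quad_fun_diff[OF sym] fixed_point_stationary(1)[OF p])
  also have "\<dots> \<ge> - ?\<sigma> * (p \<bullet> (w - p)) + 1 / 2 * (- ?\<sigma> * ((w - p) \<bullet> (w - p)))"
    using psd[of "w - p"] by simp
  also have "- ?\<sigma> * (p \<bullet> (w - p)) + 1 / 2 * (- ?\<sigma> * ((w - p) \<bullet> (w - p)))
      = 1 / 2 * (?\<sigma> * (p \<bullet> p) - ?\<sigma> * (w \<bullet> w))"
    by (simp add: inner_commute algebra_simps)
  also have "\<dots> = 1 / 2 * (?\<sigma> * (1 - w \<bullet> w))"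
    by (simp only: fixed_point_stationary(3)[OF p] right_diff_distrib mult_1_right)
  finally have "1 / 2 * (?\<sigma> * (1 - w \<bullet> w)) \<le> quad_fun A a w - quad_fun A a p" .
  moreover have "0 \<le> ?\<sigma> * (1 - w \<bullet> w)"
    using w multiplier_nonneg[of p] by (simp add: unit_ball_def)
  ultimately show ?thesis by linarith
qed

section \<open>Dynamics of eigencomponents orthogonal to the linear term\<close>

text \<open>The gradient step scales this component by \<open>1 - \<eta> * lam\<close>, and the
  projection rescales the whole vector. The factor depends on \<open>e\<close> only through
  \<open>lam\<close>, so all such eigenvectors of one eigenvalue share it.\<close>

lemma eigencomponent_step:
  assumes e: "A *v e = lam *\<^sub>R e" and ae: "a \<bullet> e = 0"
  shows "z (Suc k) \<bullet> e = (1 - \<eta> * lam) / (1 + \<eta> * multiplier (z k)) * (z k \<bullet> e)"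
proof -
  have "(A *v z k) \<bullet> e = lam * (z k \<bullet> e)"
    using symmetric_matrix_inner[OF sym, of "z k" e] by (simp add: e)
  then show ?thesis
    unfolding step proj_ball_multiplier
    by (simp add: quad_grad_def inner_diff_left inner_add_left ae algebra_simps diff_divide_distrib)
qed

lemma eigencomponent_prod:
  assumes "A *v e = lam *\<^sub>R e" and "a \<bullet> e = 0"
  shows "z k \<bullet> e = (\<Prod>j<k. (1 - \<eta> * lam) / (1 + \<eta> * multiplier (z j))) * (z 0 \<bullet> e)"
  by (induction k) (simp_all add: eigencomponent_step[OF assms])

lemma multiplier_limit_ge:
  assumes lim: "(\<lambda>k. multiplier (z k)) \<longlonglongrightarrow> \<sigma>"
    and v: "A *v v = lam *\<^sub>R v" "a \<bullet> v = 0" "z 0 \<bullet> v \<noteq> 0"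
  shows "- lam \<le> \<sigma>"
proof (rule ccontr)
  assume "\<not> - lam \<le> \<sigma>"
  have "0 \<le> \<sigma>" using lim multiplier_nonneg by (intro LIMSEQ_le_const) auto
  \<comment> \<open>The midpoint leaves room on both sides: the multipliers are eventually below
    \<open>b\<close>, while \<open>b < - lam\<close> makes the growth rate \<open>\<theta>\<close>
    exceed 1.\<close>
  define b where "b = (- lam + \<sigma>) / 2"
  have b: "\<sigma> < b" "b < - lam" "0 < b"
    using \<open>\<not> - lam \<le> \<sigma>\<close> \<open>0 \<le> \<sigma>\<close> by (auto simp: b_def)
  define \<theta> where "\<theta> = (1 - \<eta> * lam) / (1 + \<eta> * b)"
  have "1 < \<theta>"
    using b \<eta>_pos mult_strict_left_mono[OF b(2) \<eta>_pos] by (simp add: \<theta>_def less_divide_eq add_pos_pos)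
  obtain N where N: "\<And>k. k \<ge> N \<Longrightarrow> multiplier (z k) < b"
    using order_tendstoD(2)[OF lim b(1)] by (auto simp: eventually_sequentially)
  have grow: "\<theta> * \<bar>z k \<bullet> v\<bar> \<le> \<bar>z (Suc k) \<bullet> v\<bar>" if "k \<ge> N" for k
  proof -
    have "0 \<le> 1 - \<eta> * lam"
      using b \<eta>_pos mult_strict_left_mono[OF b(2) \<eta>_pos] mult_pos_pos[OF \<eta>_pos b(3)] by linarith
    moreover have "1 + \<eta> * multiplier (z k) \<le> 1 + \<eta> * b"
      using N[OF that] \<eta>_pos by simp
    ultimately have "\<theta> \<le> (1 - \<eta> * lam) / (1 + \<eta> * multiplier (z k))"
      unfolding \<theta>_def using denominator_pos[of "z k"] by (intro divide_left_mono) auto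
    then have "\<theta> * \<bar>z k \<bullet> v\<bar> \<le> \<bar>(1 - \<eta> * lam) / (1 + \<eta> * multiplier (z k))\<bar> * \<bar>z k \<bullet> v\<bar>"
      by (intro mult_right_mono order_trans[OF _ abs_ge_self] abs_ge_zero)
    also have "\<dots> = \<bar>z (Suc k) \<bullet> v\<bar>"
      by (simp only: eigencomponent_step[OF v(1,2)] abs_mult)
    finally show ?thesis .
  qed
  have pow: "\<theta> ^ k * \<bar>z N \<bullet> v\<bar> \<le> \<bar>z (N + k) \<bullet> v\<bar>" for k
  proof (induction k)
    case (Suc k)
    have "\<theta> ^ Suc k * \<bar>z N \<bullet> v\<bar> = \<theta> * (\<theta> ^ k * \<bar>z N \<bullet> v\<bar>)" by simp
    also have "\<dots> \<le> \<theta> * \<bar>z (N + k) \<bullet> v\<bar>"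
      using Suc \<open>1 < \<theta>\<close> by (intro mult_left_mono) auto
    also have "\<dots> \<le> \<bar>z (N + Suc k) \<bullet> v\<bar>" using grow[of "N + k"] by simp
    finally show ?case .
  qed simp
  \<comment> \<open>Geometric growth starts only at \<open>N\<close>, so the component must not have
    been annihilated before: no factor is zero.\<close>
  have "1 - \<eta> * lam \<noteq> 0"
    using \<open>1 < \<theta>\<close> by (auto simp: \<theta>_def)
  moreover have "1 + \<eta> * multiplier x \<noteq> 0" for x
    using denominator_pos[of x] by simp
  ultimately have "z N \<bullet> v \<noteq> 0"
    unfolding eigencomponent_prod[OF v(1,2), of N] using v(3) by auto
  then obtain k where "norm v / \<bar>z N \<bullet> v\<bar> < \<theta> ^ k"
    using real_arch_pow[OF \<open>1 < \<theta>\<close>] by blast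
  then have "norm v < \<theta> ^ k * \<bar>z N \<bullet> v\<bar>"
    using \<open>z N \<bullet> v \<noteq> 0\<close> by (simp add: divide_less_eq)
  also have "\<dots> \<le> \<bar>z (N + k) \<bullet> v\<bar>" by (rule pow)
  also have "\<dots> \<le> norm (z (N + k)) * norm v" by (rule Cauchy_Schwarz_ineq2)
  also have "\<dots> \<le> norm v" using norm_z_le[of "N + k"] by (simp add: mult_left_le_one_le)
  finally show False by simp
qed

lemma critical_cluster_points_eq:
  assumes v: "A *v v = lam *\<^sub>R v" "a \<bullet> v = 0" "z 0 \<bullet> v \<noteq> 0"
    and r: "strict_mono r" and p: "(z \<circ> r) \<longlonglongrightarrow> p" and \<sigma>p: "multiplier p = - lam"
    and s: "strict_mono s" and q: "(z \<circ> s) \<longlonglongrightarrow> q" and \<sigma>q: "multiplier q = - lam"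
  shows "p = q"
proof -
  define e where "e = p - q"
  define \<rho> where "\<rho> k = (\<Prod>j<k. (1 - \<eta> * lam) / (1 + \<eta> * multiplier (z j)))" for k
  note p_stat = fixed_point_stationary[OF cluster_point_fixed[OF r p], unfolded \<sigma>p]
  note q_stat = fixed_point_stationary[OF cluster_point_fixed[OF s q], unfolded \<sigma>q]
  have lam: "lam \<le> 0" using multiplier_nonneg[of p] \<sigma>p by simp
  have Ae: "A *v e = lam *\<^sub>R e"
    unfolding e_def using p_stat(1) q_stat(1) by (intro eigenvector_diff) simp_all
  \<comment> \<open>This puts \<open>a\<close> in the range of \<open>lam - A\<close>, which is
    orthogonal to its kernel by symmetry, and \<open>e\<close> lies in that kernel.\<close>
  have a_eq: "a = lam *\<^sub>R p - A *v p"
    using p_stat(1) by (simp add: quad_grad_def eq_diff_eq add.commute)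
  have ae: "a \<bullet> e = 0"
    using symmetric_matrix_inner[OF sym, of p e] by (simp add: a_eq inner_diff_left Ae)
  have \<rho>_e: "z k \<bullet> e = \<rho> k * (z 0 \<bullet> e)" for k
    unfolding \<rho>_def by (rule eigencomponent_prod[OF Ae ae])
  \<comment> \<open>Since \<open>z 0 \<bullet> v\<close> is nonzero, the common product can be read
    off from the iterates, so it converges along every convergent subsequence.\<close>
  have \<rho>_v: "\<rho> k = (z k \<bullet> v) / (z 0 \<bullet> v)" for k
    using v(3) eigencomponent_prod[OF v(1,2), of k] by (simp add: \<rho>_def)
  have \<rho>_nonneg: "0 \<le> \<rho> k" for k
  proof -
    have "0 \<le> 1 - \<eta> * lam" using mult_nonneg_nonpos[of \<eta> lam] lam \<eta>_pos by simp
    then show ?thesis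
      unfolding \<rho>_def by (intro prod_nonneg divide_nonneg_pos denominator_pos)
  qed
  have ratio: "\<exists>\<rho>'. (\<rho> \<circ> t) \<longlonglongrightarrow> \<rho>' \<and> 0 \<le> \<rho>' \<and> x \<bullet> e = \<rho>' * (z 0 \<bullet> e)"
    if x: "(z \<circ> t) \<longlonglongrightarrow> x" for t x
  proof (intro exI conjI)
    have "(\<lambda>k. (z (t k) \<bullet> v) / (z 0 \<bullet> v)) \<longlonglongrightarrow> (x \<bullet> v) / (z 0 \<bullet> v)"
      using x v(3) by (intro tendsto_intros) (simp_all add: comp_def)
    then show lim: "(\<rho> \<circ> t) \<longlonglongrightarrow> (x \<bullet> v) / (z 0 \<bullet> v)"
      by (simp add: comp_def \<rho>_v)
    then show "0 \<le> (x \<bullet> v) / (z 0 \<bullet> v)"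
      using \<rho>_nonneg by (intro LIMSEQ_le_const) auto
    show "x \<bullet> e = (x \<bullet> v) / (z 0 \<bullet> v) * (z 0 \<bullet> e)"
    proof (rule LIMSEQ_unique)
      show "(\<lambda>k. z (t k) \<bullet> e) \<longlonglongrightarrow> x \<bullet> e"
        using x by (intro tendsto_intros) (simp add: comp_def)
      have "(\<lambda>k. \<rho> (t k) * (z 0 \<bullet> e)) \<longlonglongrightarrow> (x \<bullet> v) / (z 0 \<bullet> v) * (z 0 \<bullet> e)"
        using lim by (intro tendsto_mult tendsto_const) (simp add: comp_def)
      then show "(\<lambda>k. z (t k) \<bullet> e) \<longlonglongrightarrow> (x \<bullet> v) / (z 0 \<bullet> v) * (z 0 \<bullet> e)"
        by (simp only: \<rho>_e[of "t k" for k])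
    qed
  qed
  obtain \<rho>p where \<rho>p: "(\<rho> \<circ> r) \<longlonglongrightarrow> \<rho>p" "0 \<le> \<rho>p" "p \<bullet> e = \<rho>p * (z 0 \<bullet> e)"
    using ratio[OF p] by blast
  obtain \<rho>q where \<rho>q: "(\<rho> \<circ> s) \<longlonglongrightarrow> \<rho>q" "0 \<le> \<rho>q" "q \<bullet> e = \<rho>q * (z 0 \<bullet> e)"
    using ratio[OF q] by blast
  have ee: "e \<bullet> e = (\<rho>p - \<rho>q) * (z 0 \<bullet> e)"
  proof -
    have "e \<bullet> e = p \<bullet> e - q \<bullet> e" by (simp add: e_def inner_diff_left)
    then show ?thesis by (simp add: \<rho>p(3) \<rho>q(3) algebra_simps)
  qed
  have "(\<rho>p - \<rho>q) * (z 0 \<bullet> e) = 0"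
  proof (cases "lam = 0")
    case True
    \<comment> \<open>With \<open>lam = 0\<close> every factor is at most 1, so the whole sequence
      \<open>\<rho>\<close> converges and both subsequential limits coincide.\<close>
    have "decseq \<rho>"
    proof (rule decseq_SucI)
      fix k
      have "1 / (1 + \<eta> * multiplier (z k)) \<le> 1"
        using \<eta>_pos multiplier_nonneg[of "z k"] denominator_pos[of "z k"] by (simp add: divide_le_eq)
      then have "\<rho> k * (1 / (1 + \<eta> * multiplier (z k))) \<le> \<rho> k * 1"
        by (intro mult_left_mono \<rho>_nonneg)
      then show "\<rho> (Suc k) \<le> \<rho> k" by (simp add: \<rho>_def True)
    qed
    then obtain \<rho>' where \<rho>': "\<rho> \<longlonglongrightarrow> \<rho>'"
      using decseq_convergent[of \<rho> 0] \<rho>_nonneg by blast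
    have "\<rho>p = \<rho>'" "\<rho>q = \<rho>'"
      using LIMSEQ_unique[OF \<rho>p(1) LIMSEQ_subseq_LIMSEQ[OF \<rho>' r]]
        LIMSEQ_unique[OF \<rho>q(1) LIMSEQ_subseq_LIMSEQ[OF \<rho>' s]] by simp_all
    then show ?thesis by simp
  next
    case False
    \<comment> \<open>Slackness with a nonzero multiplier puts both points on the sphere, so
      \<open>p + q\<close> is orthogonal to \<open>p - q\<close>. A vanishing sum of nonnegative
      limits then makes both limits 0, unless \<open>z 0 \<bullet> e\<close> is 0 already.\<close>
    then have "p \<bullet> p = 1" "q \<bullet> q = 1" using p_stat(3) q_stat(3) by auto
    then have "p \<bullet> e + q \<bullet> e = 0" by (simp add: e_def inner_commute algebra_simps)
    then have "(\<rho>p + \<rho>q) * (z 0 \<bullet> e) = 0" by (simp add: \<rho>p(3) \<rho>q(3) algebra_simps)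
    then show ?thesis using \<rho>p(2) \<rho>q(2) by (auto simp: add_nonneg_eq_0_iff)
  qed
  then have "e = 0" using ee by (simp only: inner_eq_zero_iff)
  then show ?thesis by (simp add: e_def)
qed

theorem converges_to_global_min:
  assumes psd: "\<And>x. lam * (x \<bullet> x) \<le> x \<bullet> (A *v x)"
    and v: "A *v v = lam *\<^sub>R v" "a \<bullet> v = 0" "z 0 \<bullet> v \<noteq> 0"
  shows "\<exists>p \<in> unit_ball. (\<forall>w \<in> unit_ball. quad_fun A a p \<le> quad_fun A a w) \<and> z \<longlonglongrightarrow> p"
proof -
  obtain \<sigma> where lim: "(\<lambda>k. multiplier (z k)) \<longlonglongrightarrow> \<sigma>"
    and cl: "\<And>r p. strict_mono r \<Longrightarrow> (z \<circ> r) \<longlonglongrightarrow> p \<Longrightarrow> multiplier p = \<sigma>"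
    by (rule multiplier_converges) blast
  have ge: "- lam \<le> \<sigma>" by (rule multiplier_limit_ge[OF lim v])
  have psd': "- \<sigma> * (x \<bullet> x) \<le> x \<bullet> (A *v x)" for x
    using mult_right_mono[of "- \<sigma>" lam "x \<bullet> x"] ge psd[of x] by simp
  obtain q s where s: "strict_mono s" and q: "(z \<circ> s) \<longlonglongrightarrow> q"
    using compact_unit_ball z_in_ball unfolding compact_def by metis
  have unique: "p = q" if r: "strict_mono r" and p: "(z \<circ> r) \<longlonglongrightarrow> p" for r p
  proof (cases "\<sigma> = - lam")
    case True
    then show ?thesis
      using critical_cluster_points_eq[OF v r p _ s q] cl[OF r p] cl[OF s q] by simp
  next
    case False
    \<comment> \<open>Here \<open>- \<sigma> < lam\<close> lies below the least Rayleigh quotient,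
      so no nonzero vector satisfies this equation.\<close>
    have "A *v (p - q) = - \<sigma> *\<^sub>R (p - q)"
      using fixed_point_stationary(1)[OF cluster_point_fixed[OF r p]]
        fixed_point_stationary(1)[OF cluster_point_fixed[OF s q]] cl[OF r p] cl[OF s q]
      by (intro eigenvector_diff) simp_all
    then have "(lam + \<sigma>) * ((p - q) \<bullet> (p - q)) \<le> 0"
      using psd[of "p - q"] by (simp add: distrib_right)
    then have "(p - q) \<bullet> (p - q) \<le> 0"
      using False ge by (auto simp: mult_le_0_iff)
    then show ?thesis by (metis inner_eq_zero_iff inner_ge_zero order_antisym right_minus_eq)
  qed
  have "z \<longlonglongrightarrow> q"
    using tendsto_if_cluster_values_eq[OF compact_unit_ball z_in_ball continuous_ident unique] by simp
  moreover have "quad_fun A a q \<le> quad_fun A a w" if "w \<in> unit_ball" for w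
    using fixed_point_global_min[OF cluster_point_fixed[OF s q] _ that] psd' cl[OF s q] by simp
  moreover have "q \<in> unit_ball"
    by (rule fixed_point_stationary(2)[OF cluster_point_fixed[OF s q]])
  ultimately show ?thesis by blast
qed

end

section \<open>Random starting point and the block structure\<close>

text \<open>A hyperplane through the origin is Lebesgue null, hence null for the uniform
  distribution on the ball.\<close>

lemma AE_uniform_ball_not_orthogonal:
  fixes v :: "real ^ 'm"
  assumes "v \<noteq> 0"
  shows "AE w in uniform_measure lborel unit_ball. w \<in> unit_ball \<and> w \<bullet> v \<noteq> 0"
proof (rule AE_uniform_measureI)
  show "(unit_ball :: (real ^ 'm) set) \<in> sets lborel" by (simp add: unit_ball_eq_cball)
  have "negligible {w. v \<bullet> w = 0}" using assms by (intro negligible_hyperplane) simp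
  then have "AE w in lebesgue. w \<notin> {w. v \<bullet> w = 0}"
    unfolding negligible_iff_null_sets by (rule AE_not_in)
  then have "AE w in lborel. w \<notin> {w. v \<bullet> w = 0}"
    by (simp add: AE_completion_iff)
  then show "AE w in lborel. w \<in> unit_ball \<longrightarrow> w \<in> unit_ball \<and> w \<bullet> v \<noteq> 0"
    by (auto simp: inner_commute)
qed

theorem theorem3p5:
  fixes H :: "real ^ 'n::finite ^ 'n" and c :: "real ^ 'n"
    and A :: "real ^ ('n + 'n) ^ ('n + 'n)" and a :: "real ^ ('n + 'n)"
    and f :: "real ^ ('n + 'n) \<Rightarrow> real"
    and L \<eta> :: real
    and M :: "'w measure"
    and z :: "nat \<Rightarrow> 'w \<Rightarrow> real ^ ('n + 'n)"
  assumes sym: "transpose H = H"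
    and A: "A = block_diag H"
    and a: "a = pad_zero c"
    and f: "f = quad_fun A a"
    and L: "L = spectral_norm A"
    and \<eta>_pos: "0 < \<eta>"
    and \<eta>_less: "L \<noteq> 0 \<longrightarrow> \<eta> < 2 / L"
    and prob: "prob_space M"
    and z0_meas: "z 0 \<in> borel_measurable M"
    and z0_unif: "distr M borel (z 0) = uniform_measure lborel unit_ball"
    and step: "\<And>k \<omega>. \<omega> \<in> space M \<Longrightarrow>
      z (Suc k) \<omega> = proj_ball (z k \<omega> - \<eta> *\<^sub>R quad_grad A a (z k \<omega>))"
  shows "AE \<omega> in M. \<exists>z_opt \<in> unit_ball.
    (\<forall>w \<in> unit_ball. f z_opt \<le> f w) \<and> (\<lambda>k. z k \<omega>) \<longlonglongrightarrow> z_opt"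
proof -
  obtain lam u where u: "u \<noteq> 0" "H *v u = lam *\<^sub>R u"
    and psd: "\<And>x. lam * (x \<bullet> x) \<le> x \<bullet> (H *v x)"
    using symmetric_matrix_least_eigenvalue[OF sym] by blast
  define v :: "real ^ ('n + 'n)" where "v = (\<chi> i. case i of Inl _ \<Rightarrow> 0 | Inr j \<Rightarrow> u $ j)"
  obtain j where "u $ j \<noteq> 0" using u(1) by (auto simp: vec_eq_iff)
  then have "v $ Inr j \<noteq> 0" by (simp add: v_def)
  then have "v \<noteq> 0" by auto
  have Av: "A *v v = lam *\<^sub>R v"
    using u(2)
    by (auto simp: A v_def vec_eq_iff matrix_vector_mult_def block_diag_def sum_UNIV_Plus split: sum.split)
  have av: "a \<bullet> v = 0"
    by (simp add: a v_def pad_zero_def inner_vec_def sum_UNIV_Plus)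
  \<comment> \<open>The quadratic form splits into two copies of that of \<open>H\<close>, so
    \<open>lam\<close> bounds it from below too.\<close>
  have psdA: "lam * (x \<bullet> x) \<le> x \<bullet> (A *v x)" for x
  proof -
    define y where "y = (\<chi> i. x $ Inl i)"
    define y' where "y' = (\<chi> i. x $ Inr i)"
    have "x \<bullet> x = y \<bullet> y + y' \<bullet> y'"
      by (simp add: inner_vec_def sum_UNIV_Plus y_def y'_def)
    moreover have "x \<bullet> (A *v x) = y \<bullet> (H *v y) + y' \<bullet> (H *v y')"
      by (simp add: A inner_vec_def matrix_vector_mult_def block_diag_def sum_UNIV_Plus y_def y'_def)
    ultimately show ?thesis using psd[of y] psd[of y'] by (simp add: distrib_left)
  qed
  have "0 \<le> L"
    unfolding L spectral_norm_def by (rule onorm_pos_le[OF matrix_vector_mul_bounded_linear])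
  then have \<eta>L: "\<eta> * spectral_norm A < 2"
    using \<eta>_less L by (cases "L = 0") (auto simp: less_divide_eq)
  have "AE w in distr M borel (z 0). w \<in> unit_ball \<and> w \<bullet> v \<noteq> 0"
    unfolding z0_unif by (rule AE_uniform_ball_not_orthogonal[OF \<open>v \<noteq> 0\<close>])
  then have "AE \<omega> in M. z 0 \<omega> \<in> unit_ball \<and> z 0 \<omega> \<bullet> v \<noteq> 0"
    by (rule AE_distrD[OF z0_meas])
  then show ?thesis
  proof (rule AE_mp, intro AE_I2 impI)
    fix \<omega> assume \<omega>: "\<omega> \<in> space M" "z 0 \<omega> \<in> unit_ball \<and> z 0 \<omega> \<bullet> v \<noteq> 0"
    \<comment> \<open>From here on the outcome \<open>\<omega>\<close> is fixed and the argument is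
      deterministic.\<close>
    interpret projected_gradient A a \<eta> "\<lambda>k. z k \<omega>"
      using \<omega> \<eta>_pos \<eta>L step by unfold_locales (simp_all add: A transpose_block_diag[OF sym])
    show "\<exists>z_opt \<in> unit_ball. (\<forall>w \<in> unit_ball. f z_opt \<le> f w) \<and> (\<lambda>k. z k \<omega>) \<longlonglongrightarrow> z_opt"
      unfolding f using converges_to_global_min[OF psdA Av av] \<omega>(2) by blast
  qed
qed

end
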